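(* Let $G$ be a finite simple graph with vertex set $V(G)=\{v_1,\dots,v_n\}$ and at least one edge, let $k=\operatorname{diam}(G)$ (so $1\le k\le n-1$), and let $X^{dist-k}(G)=[x_{ij}]$ ($1\le i\le n$, $1\le j\le k$) be its neighbor matrix, where row $i$ is the row of vertex $v_i$. (a) $G$ is connected if and only if $\sum_{i=1}^n\sum_{j=1}^k x_{ij}=n(n-1)$. Moreover, the number of connected components of $G$ is $$\kappa(G)=\sum_{d=1}^{n-1}\frac{|\mathscr{S}_d|}{d+1},\qquad \mathscr{S}_d=\Big\{v_i : \sum_{j=1}^k x_{ij}=d\Big\}.$$ If, in addition, $G$ is connected, then the following hold. (b) The radius of $G$ is $\operatorname{rad}(G)=\max\{j : x_{ij}\neq 0 \text{ for all } i,\ 1\le i\le n\}$. (c) The center of $G$ is $Cen(G)=G[\{v_i : x_{i\,\operatorname{rad}(G)}\ne 0 \text{ and } x_{ij}=0 \text{ for all } j>\operatorname{rad}(G)\}]$. (d) The closeness centrality of vertex $v_i$ is $CC_i=\dfrac{n-1}{\sum_{j=1}^k j\cdot x_{ij}}$. (e) The average distance between vertices in $G$ is $$\frac{1}{n(n-1)}\sum_{i=1}^n\sum_{j=1}^k (j\cdot x_{ij})=\frac{1}{n(n-1)}\sum_{j=1}^k\sum_{i=1}^n (j\cdot x_{ij}).$$ (f) The periphery of $G$ is $Per(G)=G[\{v_i : 1\le i\le n,\ x_{ik}\neq 0\}]$, where $k=\operatorname{diam}(G)$ is the number of columns of $X^{dist-k}(G)$. (g) The first column of $X^{dist-k}(G)$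 is a representation of the degree sequence of $G$, in which the degree centrality of $v_i$ is the first entry $x_{i1}$ of row $i$; the number of edges of $G$ is the half-sum of the entries of the first column, $m=\frac12\sum_{i=1}^n x_{i1}$; and the density of $G$ is $\dfrac{m}{\binom n2}=\dfrac{2m}{n(n-1)}$ with this value of $m$. (h) For each column $j$ ($1\le j\le k$), $\sum_{i=1}^n x_{ij}=2\left(|E(G^j)|-|E(G^{j-1})|\right)$. (i) For each $s$ with $1\le s\le \operatorname{diam}(G)$, the number of edges in the power graph $G^s$ is given by $\sum_{j=1}^s\sum_{i=1}^n x_{ij}=2|E(G^s)|$.
   Context: Graphs are simple (no loops or multiple edges). $d(u,v)$ is the length of a shortest path between $u$ and $v$; by convention $d(u,v)=0$ if $u,v$ lie in different components (so such pairs are never counted as distance-$j$ neighbors for $j\ge1$). The eccentricity of $v$ is $e(v)=\max\{d(v,w):w\in V(G)\}$; $\operatorname{rad}(G)=\min_v e(v)$; $\operatorname{diam}(G)=\max_v e(v)$. $G[S]$ is the subgraph induced by $S\subseteq V(G)$; $Cen(G)=G[\{v: e(v)=\operatorname{rad}(G)\}]$ and $Per(G)=G[\{v:e(v)=\operatorname{diam}(G)\}]$. Distance-$j$ neighborhood: $N^{dist-j}(v)=\{u\in V(G): d(u,v)=j\}$ for $j\ge1$. Neighbor matrix: with $k=\operatorname{diam}(G)$, $X^{dist-k}(G)$ is the $n\times k$ matrix with entries $x_{ij}=|N^{dist-j}(v_i)|$, whose rows are sorted in non-increasing order of the first column, ties being broken by non-increasing order of the second column, then the third, and so on; vertices are indexed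 so that row $i$ belongs to $v_i$. The closeness centrality of a vertex is the inverse of its mean distance to the other $n-1$ vertices. The average distance is $\frac{2}{n(n-1)}\sum d(v_i,v_j)$ over unordered pairs $i\ne j$. The degree centrality of a vertex is its degree. The density of a graph with $m$ edges is $m/\binom n2$. The degree sequence is the non-increasing list of degrees. The $s$-th power $G^s$ has vertex set $V(G)$ and edge set $\{uv: u\neq v,\ d_G(u,v)\le s\}$; in particular $G^0$ has no edges when $G$ is connected.
   Formalization: In (a), the printed formula for κ(G) fails when G has isolated vertices (K₂+K₁: the sum is 1, but κ=2); it is proved with the sum starting at d=0 for all G, and as printed (from d=1) for G without isolated vertices. *)

theory Defs
  imports Complex_Main "HOL-Library.Multiset" "Graph_Theory.Graph_Theory"
begin

text \<open>
  A finite simple graph is a \<^locale>\<open>pair_graph\<close>: finite, symmetric, loop-free, without parallel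
  arcs.  An undirected edge \<open>uv\<close> is thus represented by the two arcs \<open>(u, v)\<close> and \<open>(v, u)\<close>;
  \<open>uedges\<close> recovers the set of undirected edges.
\<close>

definition uedges :: "'a pair_pre_digraph \<Rightarrow> 'a set set" where
  "uedges G = {{u, w} | u w. (u, w) \<in> parcs G}"

definition degree :: "'a pair_pre_digraph \<Rightarrow> 'a \<Rightarrow> nat" where
  "degree G u = card {e \<in> uedges G. u \<in> e}"

text \<open>Non-increasing, with multiplicities.\<close>

definition degree_sequence :: "'a pair_pre_digraph \<Rightarrow> nat list" where
  "degree_sequence G =
     rev (sorted_list_of_multiset (image_mset (degree G) (mset_set (pverts G))))"

definition density :: "'a pair_pre_digraph \<Rightarrow> real" where
  "density G = real (card (uedges G)) / real (card (pverts G) choose 2)"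

text \<open>
  Because of maximality the components are induced subgraphs, so it is harmless that
  \<^const>\<open>pre_digraph.max_subgraph\<close> also ranges over non-symmetric subdigraphs.
\<close>

definition components :: "'a pair_pre_digraph \<Rightarrow> ('a, 'a \<times> 'a) pre_digraph set" where
  "components G =
     {H. pre_digraph.max_subgraph (with_proj G) Digraph_Component.connected H}"

text \<open>Vertices in different components have distance 0 by convention.\<close>

definition gdist :: "'a pair_pre_digraph \<Rightarrow> 'a \<Rightarrow> 'a \<Rightarrow> nat" where
  "gdist G u w =
     (if \<exists>p. pre_digraph.apath (with_proj G) u p w
      then LEAST l. \<exists>p. pre_digraph.apath (with_proj G) u p w \<and> length p = l
      else 0)"

definition eccentricity :: "'a pair_pre_digraph \<Rightarrow> 'a \<Rightarrow> nat" where
  "eccentricity G u = Max (gdist G u ` pverts G)"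

definition radius :: "'a pair_pre_digraph \<Rightarrow> nat" where
  "radius G = Min (eccentricity G ` pverts G)"

definition diameter :: "'a pair_pre_digraph \<Rightarrow> nat" where
  "diameter G = Max (eccentricity G ` pverts G)"

definition graph_center :: "'a pair_pre_digraph \<Rightarrow> ('a, 'a \<times> 'a) pre_digraph" where
  "graph_center G = with_proj G \<restriction> {u \<in> pverts G. eccentricity G u = radius G}"

definition periphery :: "'a pair_pre_digraph \<Rightarrow> ('a, 'a \<times> 'a) pre_digraph" where
  "periphery G = with_proj G \<restriction> {u \<in> pverts G. eccentricity G u = diameter G}"

definition closeness :: "'a pair_pre_digraph \<Rightarrow> 'a \<Rightarrow> real" where
  "closeness G u =
     inverse ((\<Sum>w \<in> pverts G - {u}. real (gdist G u w)) / (real (card (pverts G)) - 1))"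

text \<open>
  Since the distance convention puts \<open>gdist G u w = 0\<close> for vertices of different components,
  such pairs are joined in every power of a disconnected graph.
\<close>

definition graph_power :: "'a pair_pre_digraph \<Rightarrow> nat \<Rightarrow> 'a pair_pre_digraph" where
  "graph_power G s =
     \<lparr>pverts = pverts G,
      parcs = {(u, w). u \<in> pverts G \<and> w \<in> pverts G \<and> u \<noteq> w \<and> gdist G u w \<le> s}\<rparr>"

definition dist_nbhd :: "'a pair_pre_digraph \<Rightarrow> nat \<Rightarrow> 'a \<Rightarrow> 'a set" where
  "dist_nbhd G j u = {w \<in> pverts G. gdist G u w = j}"

definition neighbor_row :: "'a pair_pre_digraph \<Rightarrow> 'a \<Rightarrow> nat list" where
  "neighbor_row G u = map (\<lambda>j. card (dist_nbhd G j u)) [1..<diameter G + 1]"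

text \<open>
  An enumeration \<open>v 1, \<dots>, v n\<close> of the vertices (values outside \<open>{1..n}\<close> are irrelevant) for which
  the rows of the neighbor matrix are in lexicographically non-increasing order.
\<close>

definition neighbor_indexing :: "'a pair_pre_digraph \<Rightarrow> (nat \<Rightarrow> 'a) \<Rightarrow> bool" where
  "neighbor_indexing G v \<longleftrightarrow>
     bij_betw v {1..card (pverts G)} (pverts G) \<and>
     (\<forall>i \<in> {1..card (pverts G)}. \<forall>i' \<in> {1..card (pverts G)}. i < i' \<longrightarrow>
        neighbor_row G (v i') = neighbor_row G (v i) \<or>
        (neighbor_row G (v i'), neighbor_row G (v i)) \<in> lexord less_than)"

text \<open>Indices start at 1; the matrix consists of the entries with \<open>1 \<le> i \<le> n\<close>, \<open>1 \<le> j \<le> k\<close>.\<close>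

definition neighbor_matrix :: "'a pair_pre_digraph \<Rightarrow> (nat \<Rightarrow> 'a) \<Rightarrow> nat \<Rightarrow> nat \<Rightarrow> nat" where
  "neighbor_matrix G v i j = card (dist_nbhd G j (v i))"

text \<open>
  The vertices whose row sum is \<open>d\<close>.  Isolated vertices form the class \<open>d = 0\<close>, and each of them
  is a component of its own: a formula for the number of components that sums over \<open>d \<ge> 1\<close>
  only is off by their number.
\<close>

definition row_sum_class :: "'a pair_pre_digraph \<Rightarrow> (nat \<Rightarrow> 'a) \<Rightarrow> nat \<Rightarrow> 'a set" where
  "row_sum_class G v d =
     {v i | i. i \<in> {1..card (pverts G)} \<and> (\<Sum>j = 1..diameter G. neighbor_matrix G v i j) = d}"

text \<open>Each unordered pair of distinct vertices occurs once, as \<open>{v i, v j}\<close> with \<open>i < j\<close>.\<close>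

definition average_distance :: "'a pair_pre_digraph \<Rightarrow> (nat \<Rightarrow> 'a) \<Rightarrow> real" where
  "average_distance G v =
     2 / (real (card (pverts G)) * (real (card (pverts G)) - 1)) *
       (\<Sum>(i, j) \<in> {(i, j). 1 \<le> i \<and> i < j \<and> j \<le> card (pverts G)}. real (gdist G (v i) (v j)))"

end

theory Submission
  imports Defs
begin

text \<open>
  The row of \<open>u\<close> records the sizes of the distance classes of \<open>u\<close>.  As distance 0 is attained at
  \<open>u\<close> itself and at the vertices of other components, the row sum is one less than the size of the
  component of \<open>u\<close>; summing the reciprocals of the component sizes over all vertices counts the
  components.  Walking along a shortest path from \<open>u\<close> to a farthest vertex shows that the nonzero
  entries of the row are exactly those up to the eccentricity of \<open>u\<close>, which yields radius, center
  and periphery.  In a connected graph the sum of the first \<open>s\<close> columns counts the arcs of the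
  \<open>s\<close>-th power.
\<close>

section \<open>Indexed sets of vertices and counting of edges\<close>

text \<open>As \<open>v\<close> runs through all vertices, a condition on rows is a condition on
  vertices. This removes the indices from row sum classes, center and periphery.\<close>

lemma neighbor_indexing_Collect:
  assumes "neighbor_indexing G v"
  shows "{v i | i. i \<in> {1..card (pverts G)} \<and> P (v i)} = {u \<in> pverts G. P u}"
proof -
  have "v ` {1..card (pverts G)} = pverts G"
    using assms by (simp add: neighbor_indexing_def bij_betw_def)
  moreover have "{v i | i. i \<in> {1..card (pverts G)} \<and> P (v i)} = {u \<in> v ` {1..card (pverts G)}. P u}"
    by blast
  ultimately show ?thesis by (simp only:)
qed

text \<open>The fibre of \<open>(u, w)\<close> \<mapsto> \<open>{u, w}\<close> over an edge consists
  of its two orientations. The conditions are on the arcs alone so that powers of a graph are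
  covered.\<close>

lemma two_card_uedges:
  assumes "finite (parcs G)" "\<And>u w. (u, w) \<in> parcs G \<Longrightarrow> u \<noteq> w \<and> (w, u) \<in> parcs G"
  shows "2 * card (uedges G) = card (parcs G)"
proof -
  have uedges: "uedges G = (\<lambda>(u, w). {u, w}) ` parcs G"
    unfolding uedges_def by force
  have "card (parcs G) = (\<Sum>e\<in>uedges G. card {a \<in> parcs G. (\<lambda>(u, w). {u, w}) a = e})"
    using sum.image_gen[OF assms(1), of "\<lambda>_. 1::nat" "\<lambda>(u, w). {u, w}"] by (simp add: uedges)
  also have "\<dots> = (\<Sum>e\<in>uedges G. 2)"
  proof (rule sum.cong[OF refl])
    fix e assume "e \<in> uedges G"
    then obtain u w where e: "e = {u, w}" "(u, w) \<in> parcs G" by (auto simp: uedges_def)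
    then have "{a \<in> parcs G. (\<lambda>(u, w). {u, w}) a = e} = {(u, w), (w, u)}"
      using assms(2) by (auto simp: doubleton_eq_iff)
    then show "card {a \<in> parcs G. (\<lambda>(u, w). {u, w}) a = e} = 2"
      using assms(2)[OF e(2)] by simp
  qed
  finally show ?thesis by simp
qed

section \<open>Connectedness versus strong connectedness in symmetric digraphs\<close>

lemma (in wf_digraph) strongly_connected_imp_connected:
  assumes "strongly_connected G" shows "Digraph_Component.connected G"
  by (rule connectedI) (use assms in \<open>auto simp: strongly_connected_def intro!: reachable_mk_symmetricI\<close>)

text \<open>Induced subgraphs inherit symmetry, and in a symmetric digraph every undirected walk can
  be directed.\<close>

lemma (in sym_digraph) induced_connected_iff_strongly_connected:
  assumes "induced_subgraph H G"
  shows "Digraph_Component.connected H \<longleftrightarrow> strongly_connected H"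
proof -
  interpret H: sym_digraph H using assms by (rule induced_graph_imp_graph)
  show ?thesis
    using H.symmetric_connected_imp_strongly_connected[OF H.sym_arcs]
      H.strongly_connected_imp_connected by blast
qed

text \<open>Adding arcs on the same vertices keeps a digraph connected. Hence a maximal connected
  subdigraph is induced.\<close>

lemma arc_mono_connected: "arc_mono Digraph_Component.connected"
  unfolding arc_mono_def
  by (metis spanning_def subgraphE wf_digraph.connected_spanning_imp_connected)

text \<open>
  A connected subdigraph need not be strongly connected, but a maximal one is induced and thus
  symmetric.
\<close>

lemma (in sym_digraph) max_subgraph_connected_iff:
  "max_subgraph Digraph_Component.connected H \<longleftrightarrow> max_subgraph strongly_connected H"
proof
  assume max: "max_subgraph Digraph_Component.connected H"
  then have H: "induced_subgraph H G" using arc_mono_connected by (rule induced_subgraphI_arc_mono)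
  show "max_subgraph strongly_connected H"
  proof (rule max_subgraphI)
    show "strongly_connected H"
      using max H by (simp add: max_subgraph_def induced_connected_iff_strongly_connected)
    show "subgraph H G" using max by (rule subgraphI_max_subgraph)
    fix K assume K: "H \<noteq> K" "subgraph H K" "subgraph K G"
    then have "\<not> Digraph_Component.connected K" using max by (auto simp: max_subgraph_def)
    then show "\<not> strongly_connected K"
      using K wf_digraph.strongly_connected_imp_connected by blast
  qed
next
  assume max: "max_subgraph strongly_connected H"
  then have H: "induced_subgraph H G" by (rule induced_subgraphI_arc_mono) simp
  show "max_subgraph Digraph_Component.connected H"
  proof (rule max_subgraphI)
    show "Digraph_Component.connected H"
      using max H by (simp add: max_subgraph_def induced_connected_iff_strongly_connected)
    show "subgraph H G" using max by (rule subgraphI_max_subgraph)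
    fix K assume K: "H \<noteq> K" "subgraph H K" "subgraph K G"
    \<comment> \<open>\<open>K\<close> may lack symmetry, so its connectedness says nothing about
      strong connectedness. The subgraph induced on its vertices is symmetric, still connected, and
      contains \<open>K\<close>.\<close>
    let ?I = "G \<restriction> verts K"
    have I: "induced_subgraph ?I G" using K by (auto simp: subgraph_def)
    have KI: "subgraph K ?I" using K(3) by (rule subgraph_induce_subgraphI2)
    show "\<not> Digraph_Component.connected K"
    proof
      assume "Digraph_Component.connected K"
      then have "Digraph_Component.connected ?I"
        using arc_mono_connected KI unfolding arc_mono_def by (metis induce_subgraph_verts)
      then have "strongly_connected ?I" using I by (simp add: induced_connected_iff_strongly_connected)
      moreover have "subgraph H ?I" using K(2) KI by (rule subgraph_trans)
      ultimately have "?I = H" using max I by (auto simp: max_subgraph_def)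
      \<comment> \<open>\<open>K\<close> is squeezed between \<open>H\<close> and
        \<open>?I\<close>.\<close>
      then have "H = K" using K(2) KI by (auto simp: subgraph_def compatible_def)
      then show False using K(1) by simp
    qed
  qed
qed

section \<open>Distance\<close>

context pair_graph begin

lemma gdist_eq_0_if_not_reachable:
  assumes "\<not> u \<rightarrow>\<^sup>*\<^bsub>with_proj G\<^esub> w" shows "gdist G u w = 0"
  using assms by (simp add: gdist_def reachable_apath)

lemma shortest_apath:
  assumes "u \<rightarrow>\<^sup>*\<^bsub>with_proj G\<^esub> w"
  obtains p where "apath u p w" "length p = gdist G u w"
proof -
  have ex: "\<exists>p. apath u p w" using assms by (simp add: reachable_apath)
  then have "\<exists>l p. apath u p w \<and> length p = l" by blast
  from LeastI_ex[OF this] show thesis using that ex by (auto simp: gdist_def)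
qed

text \<open>\<open>gdist\<close> minimizes over paths only, but cutting the cycles out of a walk
  leaves a path whose arcs are distinct and all occur in the walk, so it is no longer than the
  walk.\<close>

lemma gdist_le_length_awalk:
  assumes "awalk u p w" shows "gdist G u w \<le> length p"
proof -
  let ?q = "awalk_to_apath p"
  have q: "apath u ?q w" using assms by (rule apath_awalk_to_apath)
  then have "gdist G u w \<le> length ?q" by (auto simp: gdist_def intro: Least_le)
  also have "length ?q = card (set ?q)"
    using q by (metis apath_def distinct_card distinct_verts_imp_distinct)
  also have "\<dots> \<le> card (set p)"
    using awalk_to_apath_subset[OF assms] by (simp add: card_mono)
  also have "\<dots> \<le> length p" by (rule card_length)
  finally show ?thesis .
qed

lemma gdist_self [simp]: "u \<in> pverts G \<Longrightarrow> gdist G u u = 0"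
  using gdist_le_length_awalk[of u "[]" u] by (simp add: awalk_Nil_iff)

text \<open>The value 0 stands both for equality and for unreachability; positivity excludes both at
  once.\<close>

lemma gdist_pos_iff: "0 < gdist G u w \<longleftrightarrow> u \<rightarrow>\<^sup>*\<^bsub>with_proj G\<^esub> w \<and> u \<noteq> w"
proof (cases "u \<rightarrow>\<^sup>*\<^bsub>with_proj G\<^esub> w")
  case True
  then obtain p where p: "apath u p w" "length p = gdist G u w" by (rule shortest_apath)
  show ?thesis
  proof (cases "u = w")
    case True
    then show ?thesis using \<open>u \<rightarrow>\<^sup>*\<^bsub>with_proj G\<^esub> w\<close> by (simp add: reachable_in_verts)
  next
    case False
    then have "p \<noteq> []" using p by (auto simp: apath_simps)
    then show ?thesis using p True False by (metis length_greater_0_conv)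
  qed
qed (simp add: gdist_eq_0_if_not_reachable)

text \<open>Reversing a shortest path gives one inequality, and by exchange the other. Unreachable
  pairs have the default 0 on both sides.\<close>

lemma gdist_commute: "gdist G u w = gdist G w u"
proof -
  have "gdist G u w \<le> gdist G w u" if "u \<rightarrow>\<^sup>*\<^bsub>with_proj G\<^esub> w" for u w
  proof -
    have "w \<rightarrow>\<^sup>*\<^bsub>with_proj G\<^esub> u" using that by (rule symmetric_reachable')
    then obtain p where p: "apath w p u" "length p = gdist G w u" by (rule shortest_apath)
    then have "awalk u (rev_path p) w" by (simp add: awalkI_apath)
    moreover have "length (rev_path p) = length p" by (induct p) auto
    ultimately show ?thesis using gdist_le_length_awalk p by metis
  qed
  then show ?thesis
    by (metis gdist_eq_0_if_not_reachable symmetric_reachable' le_antisym)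
qed

lemma gdist_eq_1_iff: "gdist G u w = 1 \<longleftrightarrow> (u, w) \<in> parcs G"
proof
  assume *: "gdist G u w = 1"
  then have "u \<rightarrow>\<^sup>*\<^bsub>with_proj G\<^esub> w" using gdist_pos_iff[of u w] by simp
  then obtain p where "apath u p w" "length p = 1" using * shortest_apath by metis
  then show "(u, w) \<in> parcs G" by (cases p) (auto simp: apath_simps)
next
  assume *: "(u, w) \<in> parcs G"
  then have "gdist G u w \<le> 1"
    using gdist_le_length_awalk[of u "[(u, w)]" w] by (auto simp: awalk_simps wellformed')
  moreover have "0 < gdist G u w"
    using * no_loops' by (auto simp: gdist_pos_iff)
  ultimately show "gdist G u w = 1" by simp
qed

text \<open>Prefixes of shortest paths are shortest, so the vertex reached after \<open>j\<close>
  arcs has distance exactly \<open>j\<close>.\<close>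

lemma ex_gdist_eq:
  assumes "u \<in> pverts G" "j \<le> gdist G u w"
  shows "\<exists>w'\<in>pverts G. gdist G u w' = j"
proof (cases "u \<rightarrow>\<^sup>*\<^bsub>with_proj G\<^esub> w")
  case True
  then obtain p where p: "apath u p w" "length p = gdist G u w" by (rule shortest_apath)
  define q r where "q = take j p" and "r = drop j p"
  define w' where "w' = awlast u q"
  have "p = q @ r" by (simp add: q_def r_def)
  with p have q: "awalk u q w'" and r: "awalk w' r w"
    by (auto simp: w'_def dest: awalkI_apath)
  have len: "length q = j" "length r = gdist G u w - j"
    using p assms by (auto simp: q_def r_def)
  have "u \<rightarrow>\<^sup>*\<^bsub>with_proj G\<^esub> w'" using q by (auto simp: reachable_awalk)
  then obtain s where s: "apath u s w'" "length s = gdist G u w'" by (rule shortest_apath)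
  \<comment> \<open>Replacing the prefix \<open>q\<close> by a shortest path \<open>s\<close> to
    \<open>w'\<close> cannot give a walk to \<open>w\<close> shorter than the distance.\<close>
  then have "awalk u (s @ r) w" using r by (meson awalk_appendI awalkI_apath)
  from gdist_le_length_awalk[OF this] have "j \<le> gdist G u w'"
    using s len assms by simp
  moreover have "gdist G u w' \<le> j" using gdist_le_length_awalk[OF q] len by simp
  ultimately show ?thesis using awalk_last_in_verts[OF q] by auto
next
  case False
  \<comment> \<open>The default distance 0 leaves only \<open>j = 0\<close>, which \<open>u\<close>
    itself attains.\<close>
  then have "j = 0" using assms by (simp add: gdist_eq_0_if_not_reachable)
  then show ?thesis using assms by (intro bexI[of _ u]) simp_all
qed

text \<open>A path visits one more vertex than it has arcs, and all of them are distinct.\<close>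

lemma gdist_le_card: "gdist G u w \<le> card (pverts G) - 1"
proof (cases "u \<rightarrow>\<^sup>*\<^bsub>with_proj G\<^esub> w")
  case True
  then obtain p where p: "apath u p w" "length p = gdist G u w" by (rule shortest_apath)
  have "Suc (length p) = card (set (awalk_verts u p))"
    using p length_awalk_verts[of u p] by (simp add: apath_def distinct_card)
  also have "\<dots> \<le> card (pverts G)"
    using p by (intro card_mono) (auto simp: apath_def elim!: awalkE')
  finally show ?thesis using p by simp
qed (simp add: gdist_eq_0_if_not_reachable)


section \<open>Eccentricity, radius and diameter as attained extrema\<close>

lemma gdist_le_eccentricity:
  assumes "w \<in> pverts G" shows "gdist G u w \<le> eccentricity G u"
  using assms pair_finite_verts by (simp add: eccentricity_def)

lemma eccentricity_le_diameter:
  assumes "u \<in> pverts G" shows "eccentricity G u \<le> diameter G"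
  using assms pair_finite_verts by (simp add: diameter_def)

lemma radius_le_eccentricity:
  assumes "u \<in> pverts G" shows "radius G \<le> eccentricity G u"
  using assms pair_finite_verts by (simp add: radius_def)

lemma gdist_le_diameter:
  assumes "u \<in> pverts G" "w \<in> pverts G" shows "gdist G u w \<le> diameter G"
  using assms gdist_le_eccentricity eccentricity_le_diameter le_trans by blast

lemma eccentricity_attained:
  assumes "pverts G \<noteq> {}"
  obtains w where "w \<in> pverts G" "gdist G u w = eccentricity G u"
proof -
  have "eccentricity G u \<in> gdist G u ` pverts G"
    unfolding eccentricity_def using assms pair_finite_verts by (intro Max_in) auto
  then show thesis using that by auto
qed

lemma diameter_attained:
  assumes "pverts G \<noteq> {}"
  obtains u where "u \<in> pverts G" "eccentricity G u = diameter G"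
proof -
  have "diameter G \<in> eccentricity G ` pverts G"
    unfolding diameter_def using assms pair_finite_verts by (intro Max_in) auto
  then show thesis using that by auto
qed

lemma radius_attained:
  assumes "pverts G \<noteq> {}"
  obtains u where "u \<in> pverts G" "eccentricity G u = radius G"
proof -
  have "radius G \<in> eccentricity G ` pverts G"
    unfolding radius_def using assms pair_finite_verts by (intro Min_in) auto
  then show thesis using that by auto
qed

lemma diameter_le_card:
  assumes "pverts G \<noteq> {}" shows "diameter G \<le> card (pverts G) - 1"
  using assms by (metis diameter_attained eccentricity_attained gdist_le_card)

section \<open>Distance classes, row sums and degrees\<close>

lemma finite_dist_nbhd [simp]: "finite (dist_nbhd G j u)"
  using pair_finite_verts by (simp add: dist_nbhd_def)

text \<open>A shortest path from \<open>u\<close> to a farthest vertex meets every smaller distance.\<close>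

lemma card_dist_nbhd_neq_0_iff:
  assumes "u \<in> pverts G"
  shows "card (dist_nbhd G j u) \<noteq> 0 \<longleftrightarrow> j \<le> eccentricity G u"
proof
  assume "card (dist_nbhd G j u) \<noteq> 0"
  then obtain w where "w \<in> dist_nbhd G j u" by fastforce
  then show "j \<le> eccentricity G u"
    using gdist_le_eccentricity[of w u] by (simp add: dist_nbhd_def)
next
  assume j: "j \<le> eccentricity G u"
  have "pverts G \<noteq> {}" using assms by auto
  then obtain w where "gdist G u w = eccentricity G u" by (rule eccentricity_attained)
  then have "\<exists>w'\<in>pverts G. gdist G u w' = j" using ex_gdist_eq[OF assms] j by metis
  then show "card (dist_nbhd G j u) \<noteq> 0" by (auto simp: dist_nbhd_def card_eq_0_iff pair_finite_verts)
qed

text \<open>The classes are disjoint fibres of the distance from \<open>u\<close>. Starting at 1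
  leaves out \<open>u\<close> and the other components.\<close>

lemma sum_card_dist_nbhd:
  "(\<Sum>j = 1..s. card (dist_nbhd G j u)) = card {w \<in> pverts G. 0 < gdist G u w \<and> gdist G u w \<le> s}"
    (is "_ = card ?A")
proof -
  have "(\<Sum>j = 1..s. card (dist_nbhd G j u)) = (\<Sum>j = 1..s. card {w \<in> ?A. gdist G u w = j})"
    by (intro sum.cong arg_cong[where f = card]) (auto simp: dist_nbhd_def)
  also have "\<dots> = card ?A"
    using sum.group[of ?A "{1..s}" "gdist G u" "\<lambda>_. 1 :: nat"] pair_finite_verts by force
  finally show ?thesis .
qed

lemma sum_gdist:
  assumes "u \<in> pverts G"
  shows "(\<Sum>w\<in>pverts G. real (gdist G u w)) =
    (\<Sum>j = 1..diameter G. real j * real (card (dist_nbhd G j u)))"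
proof -
  have "(\<Sum>w\<in>pverts G. real (gdist G u w)) =
      (\<Sum>j = 0..diameter G. \<Sum>w\<in>{w \<in> pverts G. gdist G u w = j}. real (gdist G u w))"
    using pair_finite_verts gdist_le_diameter[OF assms] by (intro sum.group[symmetric]) auto
  also have "\<dots> = (\<Sum>j = 0..diameter G. real j * real (card (dist_nbhd G j u)))"
    by (intro sum.cong) (auto simp: dist_nbhd_def)
  \<comment> \<open>The class of distance 0 has weight 0 and drops out.\<close>
  finally show ?thesis by (simp add: sum.atLeast_Suc_atMost)
qed

text \<open>Sending a neighbor \<open>w\<close> to \<open>{u, w}\<close> is a bijection onto the
  edges at \<open>u\<close>.\<close>

lemma degree_eq_card_dist_nbhd: "degree G u = card (dist_nbhd G 1 u)"
proof -
  have "{e \<in> uedges G. u \<in> e} = (\<lambda>w. {u, w}) ` dist_nbhd G 1 u"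
    using arcs_symmetric
    by (auto simp: uedges_def dist_nbhd_def gdist_eq_1_iff[simplified] wellformed' doubleton_eq_iff
        image_iff)
  moreover have "inj_on (\<lambda>w. {u, w}) (dist_nbhd G 1 u)"
    by (auto simp: inj_on_def doubleton_eq_iff)
  ultimately show ?thesis by (simp add: degree_def card_image)
qed

section \<open>Components and connectedness\<close>

text \<open>By symmetry the strong component of \<open>u\<close> is everything reachable from
  \<open>u\<close>. All distances are at most the diameter, so the row misses only \<open>u\<close>
  itself, whence the \<open>Suc\<close>.\<close>

lemma card_scc_of:
  assumes "u \<in> pverts G"
  shows "card (scc_of u) = Suc (\<Sum>j = 1..diameter G. card (dist_nbhd G j u))"
proof -
  have "scc_of u = insert u {w \<in> pverts G. 0 < gdist G u w \<and> gdist G u w \<le> diameter G}"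
    using assms gdist_le_diameter[OF assms]
    by (auto simp: gdist_pos_iff scc_of_def reachable_in_verts intro: symmetric_reachable')
  moreover have "u \<notin> {w \<in> pverts G. 0 < gdist G u w \<and> gdist G u w \<le> diameter G}"
    using assms by simp
  ultimately show ?thesis using pair_finite_verts by (simp only: sum_card_dist_nbhd) simp
qed

lemma scc_of_subset: "scc_of u \<subseteq> pverts G"
  by (auto simp: scc_of_def reachable_in_verts)

text \<open>A component \<open>S\<close> contributes \<open>card S\<close> summands
  \<open>1 / card S\<close>, hence 1 in total.\<close>

lemma card_sccs_verts_eq_sum: "real (card sccs_verts) = (\<Sum>u\<in>pverts G. 1 / real (card (scc_of u)))"
proof -
  have "(\<Sum>u\<in>pverts G. 1 / real (card (scc_of u))) =
      (\<Sum>S\<in>scc_of ` pverts G. \<Sum>u\<in>{u \<in> pverts G. scc_of u = S}. 1 / real (card (scc_of u)))"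
    by (rule sum.image_gen[OF pair_finite_verts])
  also have "\<dots> = (\<Sum>S\<in>scc_of ` pverts G. 1)"
  proof (rule sum.cong[OF refl])
    fix S assume "S \<in> scc_of ` pverts G"
    then obtain u where u: "u \<in> pverts G" "S = scc_of u" by auto
    \<comment> \<open>The vertices whose component is \<open>S\<close> are the members of
      \<open>S\<close>.\<close>
    have eq: "{w \<in> pverts G. scc_of w = S} = S"
      using u scc_of_eq in_scc_of_self scc_of_subset by blast
    have "(\<Sum>u\<in>{u \<in> pverts G. scc_of u = S}. 1 / real (card (scc_of u))) =
        (\<Sum>u\<in>{u \<in> pverts G. scc_of u = S}. 1 / real (card S))"
      by (rule sum.cong) auto
    also have "\<dots> = 1" unfolding eq using u by (simp add: card_scc_of del: of_nat_sum)
    finally show "(\<Sum>u\<in>{u \<in> pverts G. scc_of u = S}. 1 / real (card (scc_of u))) = 1" .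
  qed
  finally show ?thesis by (simp add: sccs_verts_conv_scc_of)
qed

lemma connected_iff_strongly_connected:
  "Digraph_Component.connected (with_proj G) \<longleftrightarrow> strongly_connected (with_proj G)"
  by (rule induced_connected_iff_strongly_connected[OF induced_subgraph_refl])

lemma components_eq_sccs: "components G = sccs"
  by (simp add: components_def sccs_altdef2 max_subgraph_connected_iff)

lemma card_components:
  "real (card (components G)) =
    (\<Sum>u\<in>pverts G. 1 / (real (\<Sum>j = 1..diameter G. card (dist_nbhd G j u)) + 1))"
proof -
  have "real (card (components G)) = (\<Sum>u\<in>pverts G. 1 / real (card (scc_of u)))"
    using card_sccs_verts_eq_sum by (simp add: components_eq_sccs card_sccs_verts)
  also have "\<dots> = (\<Sum>u\<in>pverts G. 1 / (real (\<Sum>j = 1..diameter G. card (dist_nbhd G j u)) + 1))"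
    by (intro sum.cong refl) (simp add: card_scc_of add.commute)
  finally show ?thesis .
qed

text \<open>A row sum is at most n - 1, with equality iff the component of the vertex is the whole
  graph. The total is therefore n(n - 1) iff every row attains its bound.\<close>

lemma connected_iff_sum_dist_nbhd:
  assumes "pverts G \<noteq> {}"
  shows "Digraph_Component.connected (with_proj G) \<longleftrightarrow>
    (\<Sum>u\<in>pverts G. \<Sum>j = 1..diameter G. card (dist_nbhd G j u)) =
      card (pverts G) * (card (pverts G) - 1)"
proof -
  let ?r = "\<lambda>u. \<Sum>j = 1..diameter G. card (dist_nbhd G j u)"
  have r: "?r u = card (scc_of u) - 1" if "u \<in> pverts G" for u
    using card_scc_of[OF that] by simp
  have le: "card (scc_of u) \<le> card (pverts G)" for u
    using pair_finite_verts scc_of_subset by (intro card_mono) auto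
  have "Digraph_Component.connected (with_proj G) \<longleftrightarrow> (\<forall>u\<in>pverts G. scc_of u = pverts G)"
    using assms scc_of_subset symmetric_reachable'
    by (auto simp: connected_iff_strongly_connected strongly_connected_def scc_of_def)
  also have "\<dots> \<longleftrightarrow> (\<forall>u\<in>pverts G. ?r u = card (pverts G) - 1)"
  proof (intro ball_cong refl)
    fix u assume u: "u \<in> pverts G"
    have "scc_of u = pverts G \<longleftrightarrow> card (scc_of u) = card (pverts G)"
      using scc_of_subset pair_finite_verts card_subset_eq by metis
    also have "\<dots> \<longleftrightarrow> ?r u = card (pverts G) - 1"
      using card_scc_of[OF u] le[of u] by auto
    finally show "scc_of u = pverts G \<longleftrightarrow> ?r u = card (pverts G) - 1" .
  qed
  also have "\<dots> \<longleftrightarrow> (\<Sum>u\<in>pverts G. ?r u) = (\<Sum>u\<in>pverts G. card (pverts G) - 1)"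
  proof
    assume eq: "(\<Sum>u\<in>pverts G. ?r u) = (\<Sum>u\<in>pverts G. card (pverts G) - 1)"
    have "?r u \<le> card (pverts G) - 1" if "u \<in> pverts G" for u
      using r[OF that] le[of u] by simp
    then show "\<forall>u\<in>pverts G. ?r u = card (pverts G) - 1"
      using sum_mono_inv[OF eq] pair_finite_verts by blast
  qed (rule sum.cong[OF refl], simp)
  finally show ?thesis by simp
qed

section \<open>Edges of graph powers\<close>

text \<open>
  Connectedness matters here: with \<open>gdist\<close> set to 0 between components, powers of a
  disconnected graph have additional edges.
\<close>

lemma two_card_uedges_graph_power:
  assumes "Digraph_Component.connected (with_proj G)"
  shows "2 * card (uedges (graph_power G s)) =
    (\<Sum>j = 1..s. \<Sum>u\<in>pverts G. card (dist_nbhd G j u))"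
proof -
  have reach: "u \<rightarrow>\<^sup>*\<^bsub>with_proj G\<^esub> w" if "u \<in> pverts G" "w \<in> pverts G" for u w
    using assms that by (auto simp: connected_iff_strongly_connected strongly_connected_def)
  \<comment> \<open>As all vertices are reachable, being distinct means having positive distance;
    the arcs leaving \<open>u\<close> are then counted by the first \<open>s\<close> entries of its
    row.\<close>
  have parcs: "parcs (graph_power G s) =
      (SIGMA u:pverts G. {w \<in> pverts G. 0 < gdist G u w \<and> gdist G u w \<le> s})"
    using reach by (auto simp: graph_power_def gdist_pos_iff)
  have "2 * card (uedges (graph_power G s)) = card (parcs (graph_power G s))"
  proof (rule two_card_uedges)
    show "finite (parcs (graph_power G s))"
      using pair_finite_verts unfolding parcs by (intro finite_SigmaI) auto
  qed (auto simp: graph_power_def gdist_commute)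
  also have "\<dots> = (\<Sum>u\<in>pverts G. \<Sum>j = 1..s. card (dist_nbhd G j u))"
    using pair_finite_verts by (simp only: parcs sum_card_dist_nbhd card_SigmaI) simp
  finally show ?thesis by (simp add: sum.swap[of _ _ "pverts G"])
qed

text \<open>Turns the edge count for powers, taken at \<open>s = 1\<close>, into the one for
  \<open>G\<close>.\<close>

lemma uedges_graph_power_1:
  assumes "Digraph_Component.connected (with_proj G)"
  shows "uedges (graph_power G 1) = uedges G"
proof -
  have "gdist G u w \<le> 1 \<longleftrightarrow> (u, w) \<in> parcs G"
    if "u \<in> pverts G" "w \<in> pverts G" "u \<noteq> w" for u w
  proof -
    have "0 < gdist G u w"
      using assms that
      by (auto simp: gdist_pos_iff connected_iff_strongly_connected strongly_connected_def)
    then show ?thesis using gdist_eq_1_iff[of u w] by linarith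
  qed
  then have "parcs (graph_power G 1) = parcs G"
    using no_loops' wellformed' by (auto simp: graph_power_def)
  then show ?thesis by (simp add: uedges_def)
qed

section \<open>Radius, center and periphery\<close>

text \<open>Each row is nonzero exactly up to the eccentricity of its vertex, so column
  \<open>j\<close> has no zero iff \<open>j\<close> is at most the least eccentricity. Positive
  radius keeps the set under \<open>Max\<close> nonempty.\<close>

lemma radius_eq_Max:
  assumes "pverts G \<noteq> {}" "0 < radius G"
  shows "radius G = Max {j \<in> {1..diameter G}. \<forall>u\<in>pverts G. card (dist_nbhd G j u) \<noteq> 0}"
proof -
  obtain u where u: "u \<in> pverts G" "eccentricity G u = radius G"
    using assms(1) by (rule radius_attained)
  have "(\<forall>u\<in>pverts G. card (dist_nbhd G j u) \<noteq> 0) \<longleftrightarrow> j \<le> radius G" for j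
    using u radius_le_eccentricity card_dist_nbhd_neq_0_iff le_trans by metis
  moreover have "radius G \<le> diameter G" using u eccentricity_le_diameter by metis
  ultimately have "{j \<in> {1..diameter G}. \<forall>u\<in>pverts G. card (dist_nbhd G j u) \<noteq> 0} = {1..radius G}"
    by (auto simp del: card_0_eq)
  moreover have "Max {1..radius G} = radius G" using assms(2) by (intro Max_eqI) auto
  ultimately show ?thesis by (simp only:)
qed

lemma graph_center_eq:
  "graph_center G = with_proj G \<restriction> {u \<in> pverts G. card (dist_nbhd G (radius G) u) \<noteq> 0 \<and>
    (\<forall>j\<in>{1..diameter G}. radius G < j \<longrightarrow> card (dist_nbhd G j u) = 0)}"
proof -
  have "eccentricity G u = radius G \<longleftrightarrow> card (dist_nbhd G (radius G) u) \<noteq> 0 \<and>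
      (\<forall>j\<in>{1..diameter G}. radius G < j \<longrightarrow> card (dist_nbhd G j u) = 0)" (is "_ \<longleftrightarrow> ?R")
    if u: "u \<in> pverts G" for u
  proof
    assume "eccentricity G u = radius G"
    then show ?R using card_dist_nbhd_neq_0_iff[OF u] by (metis order_refl not_less)
  next
    assume R: ?R
    show "eccentricity G u = radius G"
    proof (rule ccontr)
      assume "eccentricity G u \<noteq> radius G"
      then have "radius G < eccentricity G u" using radius_le_eccentricity[OF u] by simp
      \<comment> \<open>The column of the eccentricity lies in the matrix, beyond the radius, and
        has a nonzero entry in row \<open>u\<close>.\<close>
      moreover from this have "eccentricity G u \<in> {1..diameter G}"
        using eccentricity_le_diameter[OF u] by simp
      ultimately show False using R card_dist_nbhd_neq_0_iff[OF u] by (metis order_refl)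
    qed
  qed
  then have "{u \<in> pverts G. eccentricity G u = radius G} = {u \<in> pverts G.
      card (dist_nbhd G (radius G) u) \<noteq> 0 \<and>
      (\<forall>j\<in>{1..diameter G}. radius G < j \<longrightarrow> card (dist_nbhd G j u) = 0)}"
    by blast
  then show ?thesis by (simp only: graph_center_def)
qed

text \<open>A nonzero last entry says that the eccentricity is at least the diameter, hence equal to
  it.\<close>

lemma periphery_eq:
  "periphery G = with_proj G \<restriction> {u \<in> pverts G. card (dist_nbhd G (diameter G) u) \<noteq> 0}"
proof -
  have "{u \<in> pverts G. eccentricity G u = diameter G} =
      {u \<in> pverts G. card (dist_nbhd G (diameter G) u) \<noteq> 0}"
    using card_dist_nbhd_neq_0_iff eccentricity_le_diameter by (metis (lifting) le_antisym order_refl)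
  then show ?thesis by (simp only: periphery_def)
qed

section \<open>Closeness, degree sequence and average distance\<close>

lemma closeness_eq:
  assumes "u \<in> pverts G"
  shows "closeness G u = (real (card (pverts G)) - 1) /
    (\<Sum>j = 1..diameter G. real j * real (card (dist_nbhd G j u)))"
proof -
  have "(\<Sum>w\<in>pverts G - {u}. real (gdist G u w)) = (\<Sum>w\<in>pverts G. real (gdist G u w))"
    using assms pair_finite_verts by (intro sum.mono_neutral_left) auto
  then show ?thesis using assms by (simp add: closeness_def sum_gdist)
qed

text \<open>Lexicographically non-increasing rows have non-increasing first entries, and a sorted
  list is determined by its multiset.\<close>

lemma degree_sequence_eq:
  assumes v: "neighbor_indexing G v" and k: "1 \<le> diameter G"
  shows "degree_sequence G = map (\<lambda>i. card (dist_nbhd G 1 (v i))) [1..<card (pverts G) + 1]"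
    (is "_ = ?L")
proof -
  let ?n = "card (pverts G)"
  let ?x = "\<lambda>i. card (dist_nbhd G 1 (v i))"
  have bij: "bij_betw v {1..?n} (pverts G)" using v by (simp add: neighbor_indexing_def)
  have mono: "?x i' \<le> ?x i" if "i \<in> {1..?n}" "i' \<in> {1..?n}" "i \<le> i'" for i i'
  proof (cases "i = i'")
    case False
    then have "neighbor_row G (v i') = neighbor_row G (v i) \<or>
        (neighbor_row G (v i'), neighbor_row G (v i)) \<in> lexord less_than"
      using v that by (simp add: neighbor_indexing_def)
    \<comment> \<open>Positive diameter makes the row nonempty, so that the lexicographic comparison
      starts with the degree.\<close>
    moreover have "neighbor_row G u = card (dist_nbhd G 1 u) #
        map (\<lambda>j. card (dist_nbhd G j u)) [2..<diameter G + 1]" for u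
      using k by (simp add: neighbor_row_def upt_conv_Cons numeral_2_eq_2 del: upt_Suc)
    ultimately show ?thesis by auto
  qed simp
  have "mset ?L = image_mset (degree G) (image_mset v (mset_set {1..?n}))"
    by (simp add: mset_map degree_eq_card_dist_nbhd atLeastLessThanSuc_atLeastAtMost
        image_mset.compositionality comp_def del: upt_Suc)
  also have "image_mset v (mset_set {1..?n}) = mset_set (pverts G)"
    using bij by (simp add: image_mset_mset_set bij_betw_def)
  finally have "degree_sequence G = rev (sort (rev ?L))"
    by (metis degree_sequence_def mset_rev sorted_list_of_multiset_mset)
  moreover have "sorted (rev ?L)"
    unfolding sorted_rev_iff_nth_mono
  proof (intro allI impI)
    fix i j assume "i \<le> j" "j < length ?L"
    then show "?L ! j \<le> ?L ! i" using mono[of "i + 1" "j + 1"] by (simp del: upt_Suc)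
  qed
  ultimately show ?thesis by (simp add: sorted_sort_id del: upt_Suc)
qed

text \<open>The sum over all ordered pairs of indices is twice the sum over \<open>i < j\<close>:
  the two triangles agree by symmetry and the diagonal vanishes. This absorbs the factor 2 of the
  definition.\<close>

lemma average_distance_eq:
  assumes v: "neighbor_indexing G v"
  shows "average_distance G v = 1 / (real (card (pverts G)) * (real (card (pverts G)) - 1)) *
    (\<Sum>u\<in>pverts G. \<Sum>w\<in>pverts G. real (gdist G u w))"
proof -
  let ?n = "card (pverts G)"
  let ?d = "\<lambda>(i, j). real (gdist G (v i) (v j))"
  let ?U = "{(i, j). 1 \<le> i \<and> i < j \<and> j \<le> ?n}" and ?L = "{(i, j). 1 \<le> j \<and> j < i \<and> i \<le> ?n}"
  let ?D = "(\<lambda>i. (i, i)) ` {1..?n}"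
  have bij: "bij_betw v {1..?n} (pverts G)" using v by (simp add: neighbor_indexing_def)
  have fin: "finite ?U" "finite ?L"
    by (rule finite_subset[of _ "{1..?n} \<times> {1..?n}"]; auto)+
  have "(\<Sum>u\<in>pverts G. \<Sum>w\<in>pverts G. real (gdist G u w)) =
      (\<Sum>i = 1..?n. \<Sum>j = 1..?n. ?d (i, j))"
    by (simp add: sum.reindex_bij_betw[OF bij, symmetric])
  also have "\<dots> = sum ?d ({1..?n} \<times> {1..?n})" by (simp add: sum.cartesian_product)
  also have "{1..?n} \<times> {1..?n} = ?U \<union> ?L \<union> ?D" by auto
  also have "sum ?d \<dots> = sum ?d (?U \<union> ?L) + sum ?d ?D"
    using fin by (intro sum.union_disjoint) auto
  also have "sum ?d (?U \<union> ?L) = sum ?d ?U + sum ?d ?L"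
    using fin by (intro sum.union_disjoint) auto
  also have "sum ?d ?L = sum ?d ?U"
    by (rule sum.reindex_bij_witness[of _ prod.swap prod.swap]) (auto simp: gdist_commute)
  also have "sum ?d ?D = 0"
    using bij bij_betwE by (intro sum.neutral) fastforce
  finally show ?thesis by (simp add: average_distance_def)
qed

section \<open>Counting components by row sums\<close>

lemma row_sum_class_eq:
  assumes "neighbor_indexing G v"
  shows "row_sum_class G v d =
    {u \<in> pverts G. (\<Sum>j = 1..diameter G. card (dist_nbhd G j u)) = d}"
  unfolding row_sum_class_def neighbor_matrix_def by (rule neighbor_indexing_Collect[OF assms])

text \<open>Groups the reciprocals of component sizes by row sum \<open>d\<close>, where the size is
  \<open>d + 1\<close>. Row sums are at most n - 1, so the range of \<open>d\<close> covers every
  vertex.\<close>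

lemma card_components_eq_sum_row_sum_class:
  assumes "neighbor_indexing G v" "pverts G \<noteq> {}"
  shows "real (card (components G)) =
    (\<Sum>d = 0..card (pverts G) - 1. real (card (row_sum_class G v d)) / (real d + 1))"
proof -
  let ?r = "\<lambda>u. \<Sum>j = 1..diameter G. card (dist_nbhd G j u)"
  have r: "?r u \<le> card (pverts G) - 1" if "u \<in> pverts G" for u
  proof -
    have "Suc (?r u) \<le> card (pverts G)"
      using card_scc_of[OF that] card_mono[OF pair_finite_verts scc_of_subset] by metis
    then show ?thesis by simp
  qed
  have "real (card (components G)) = (\<Sum>u\<in>pverts G. 1 / (real (?r u) + 1))"
    by (rule card_components)
  also have "\<dots> = (\<Sum>d = 0..card (pverts G) - 1.
      \<Sum>u\<in>{u \<in> pverts G. ?r u = d}. 1 / (real (?r u) + 1))"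
    using r pair_finite_verts by (intro sum.group[symmetric]) auto
  also have "\<dots> = (\<Sum>d = 0..card (pverts G) - 1. real (card (row_sum_class G v d)) / (real d + 1))"
    unfolding row_sum_class_eq[OF assms(1)]
    by (intro sum.cong refl) (simp del: of_nat_sum)
  finally show ?thesis .
qed

end

section \<open>Transfer to the indexed neighbor matrix\<close>

text \<open>The component count in (a) starts at \<open>d = 0\<close> to include isolated vertices;
  the sum from \<open>d = 1\<close> is given for graphs without them.\<close>

theorem theorem1:
  fixes G :: "'a pair_pre_digraph" and v :: "nat \<Rightarrow> 'a" and n k :: nat
    and x :: "nat \<Rightarrow> nat \<Rightarrow> nat" and S :: "nat \<Rightarrow> 'a set"
  assumes graph: "pair_graph G"
    and edge: "uedges G \<noteq> {}"
    and n: "n = card (pverts G)"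
    and k: "k = diameter G"
    and indexing: "neighbor_indexing G v"
    and x: "x = neighbor_matrix G v"
    and S: "S = row_sum_class G v"
  shows
    "1 \<le> k \<and> k \<le> n - 1
     \<and> \<comment> \<open>(a)\<close>
       (Digraph_Component.connected (with_proj G) \<longleftrightarrow>
          (\<Sum>i = 1..n. \<Sum>j = 1..k. x i j) = n * (n - 1))
     \<and> real (card (components G)) = (\<Sum>d = 0..n - 1. real (card (S d)) / (real d + 1))
     \<and> ((\<forall>u \<in> pverts G. degree G u \<noteq> 0) \<longrightarrow>
          real (card (components G)) = (\<Sum>d = 1..n - 1. real (card (S d)) / (real d + 1)))
     \<and> (Digraph_Component.connected (with_proj G) \<longrightarrow>
       \<comment> \<open>(b)\<close>
         radius G = Max {j \<in> {1..k}. \<forall>i \<in> {1..n}. x i j \<noteq> 0}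
       \<and> \<comment> \<open>(c)\<close>
         graph_center G =
           with_proj G \<restriction> {v i | i. i \<in> {1..n} \<and> x i (radius G) \<noteq> 0
                              \<and> (\<forall>j \<in> {1..k}. j > radius G \<longrightarrow> x i j = 0)}
       \<and> \<comment> \<open>(d)\<close>
         (\<forall>i \<in> {1..n}. closeness G (v i) = (real n - 1) / (\<Sum>j = 1..k. real j * real (x i j)))
       \<and> \<comment> \<open>(e)\<close>
         average_distance G v =
           1 / (real n * (real n - 1)) * (\<Sum>i = 1..n. \<Sum>j = 1..k. real j * real (x i j))
       \<and> 1 / (real n * (real n - 1)) * (\<Sum>i = 1..n. \<Sum>j = 1..k. real j * real (x i j)) =
           1 / (real n * (real n - 1)) * (\<Sum>j = 1..k. \<Sum>i = 1..n. real j * real (x i j))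
       \<and> \<comment> \<open>(f)\<close>
         periphery G = with_proj G \<restriction> {v i | i. i \<in> {1..n} \<and> x i k \<noteq> 0}
       \<and> \<comment> \<open>(g)\<close>
         degree_sequence G = map (\<lambda>i. x i 1) [1..<n + 1]
       \<and> (\<forall>i \<in> {1..n}. degree G (v i) = x i 1)
       \<and> real (card (uedges G)) = 1 / 2 * (\<Sum>i = 1..n. real (x i 1))
       \<and> density G = (1 / 2 * (\<Sum>i = 1..n. real (x i 1))) / real (n choose 2)
       \<and> density G = 2 * (1 / 2 * (\<Sum>i = 1..n. real (x i 1))) / (real n * (real n - 1))
       \<and> \<comment> \<open>(h)\<close>
         (\<forall>j \<in> {1..k}. (\<Sum>i = 1..n. int (x i j)) =
            2 * (int (card (uedges (graph_power G j))) - int (card (uedges (graph_power G (j - 1))))))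
       \<and> \<comment> \<open>(i)\<close>
         (\<forall>s \<in> {1..diameter G}. (\<Sum>j = 1..s. \<Sum>i = 1..n. x i j) =
            2 * card (uedges (graph_power G s))))"
proof -
  interpret pair_graph G by (rule graph)
  have bij: "bij_betw v {1..n} (pverts G)"
    using indexing by (simp add: neighbor_indexing_def n)
  have xv: "x i j = card (dist_nbhd G j (v i))" for i j
    by (simp add: x neighbor_matrix_def)
  have v_in: "v i \<in> pverts G" if "i \<in> {1..n}" for i
    using bij that by (auto simp: bij_betw_def)
  have sum_v: "(\<Sum>i = 1..n. f (v i)) = sum f (pverts G)" for f :: "'a \<Rightarrow> 'b::comm_monoid_add"
    by (rule sum.reindex_bij_betw[OF bij])
  have image_v: "{v i | i. i \<in> {1..n} \<and> P (v i)} = {u \<in> pverts G. P u}" for P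
    unfolding n by (rule neighbor_indexing_Collect[OF indexing])
  have ball_v: "(\<forall>i\<in>{1..n}. P (v i)) \<longleftrightarrow> (\<forall>u\<in>pverts G. P u)" for P
    using bij by (metis bij_betw_imp_surj_on ball_simps(9))
  \<comment> \<open>An edge supplies two vertices at distance 1, which makes the diameter
    positive.\<close>
  obtain a b where ab: "(a, b) \<in> parcs G" using edge by (auto simp: uedges_def)
  then have V: "a \<in> pverts G" "b \<in> pverts G" "a \<noteq> b" using wellformed' no_loops' by auto
  then have ne: "pverts G \<noteq> {}" by auto
  have k1: "1 \<le> k" using gdist_eq_1_iff[of a b] gdist_le_diameter[OF V(1,2)] ab k by simp
  have kn: "k \<le> n - 1" using diameter_le_card[OF ne] by (simp add: k n)
  have components: "real (card (components G)) = (\<Sum>d = 0..n - 1. real (card (S d)) / (real d + 1))"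
    unfolding n S by (rule card_components_eq_sum_row_sum_class[OF indexing ne])
  have components': "real (card (components G)) = (\<Sum>d = 1..n - 1. real (card (S d)) / (real d + 1))"
    if deg: "\<forall>u\<in>pverts G. degree G u \<noteq> 0"
  proof -
    have "(\<Sum>j = 1..diameter G. card (dist_nbhd G j u)) \<noteq> 0" if "u \<in> pverts G" for u
    proof -
      have "card (dist_nbhd G 1 u) \<noteq> 0" using deg that by (simp add: degree_eq_card_dist_nbhd)
      moreover have "1 \<in> {1..diameter G}" using k1 k by simp
      ultimately show ?thesis by (metis sum_eq_0_iff finite_atLeastAtMost)
    qed
    \<comment> \<open>A vertex of nonzero degree has a nonzero entry in column 1, so the class of
      row sum 0 is empty and its summand vanishes.\<close>
    then have "S 0 = {}" unfolding S row_sum_class_eq[OF indexing] by blast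
    then show ?thesis using components by (simp add: sum.atLeast_Suc_atMost)
  qed
  have conn: "Digraph_Component.connected (with_proj G) \<longleftrightarrow>
      (\<Sum>i = 1..n. \<Sum>j = 1..k. x i j) = n * (n - 1)"
    using connected_iff_sum_dist_nbhd[OF ne]
    unfolding xv sum_v[of "\<lambda>u. \<Sum>j = 1..k. card (dist_nbhd G j u)"] by (simp only: n k)
  have sum_dist: "(\<Sum>i = 1..n. \<Sum>j = 1..k. real j * real (x i j)) =
      (\<Sum>u\<in>pverts G. \<Sum>w\<in>pverts G. real (gdist G u w))"
    unfolding xv sum_v[of "\<lambda>u. \<Sum>j = 1..k. real j * real (card (dist_nbhd G j u))"]
    by (intro sum.cong refl) (simp add: sum_gdist k)
  have radius_pos: "0 < radius G" if con: "Digraph_Component.connected (with_proj G)"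
  proof -
    obtain u where u: "u \<in> pverts G" "eccentricity G u = radius G" using ne by (rule radius_attained)
    \<comment> \<open>One of \<open>a\<close> and \<open>b\<close> differs from the central vertex
      \<open>u\<close>, and connectedness gives it positive distance.\<close>
    obtain w where w: "w \<in> pverts G" "u \<noteq> w" using V by metis
    have "0 < gdist G u w"
      using con u w
      by (auto simp: gdist_pos_iff connected_iff_strongly_connected strongly_connected_def)
    then show ?thesis using gdist_le_eccentricity[OF w(1), of u] u by simp
  qed
  have edges: "(\<Sum>j = 1..s. \<Sum>i = 1..n. x i j) = 2 * card (uedges (graph_power G s))"
    if "Digraph_Component.connected (with_proj G)" for s
    unfolding xv sum_v[of "\<lambda>u. card (dist_nbhd G _ u)"]
    by (rule two_card_uedges_graph_power[OF that, symmetric])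
  have card_uedges: "real (card (uedges G)) = 1 / 2 * (\<Sum>i = 1..n. real (x i 1))"
    if "Digraph_Component.connected (with_proj G)"
    using edges[OF that, of 1] uedges_graph_power_1[OF that]
    by (simp flip: of_nat_sum)
  have choose: "real (n choose 2) = real n * (real n - 1) / 2"
    \<comment> \<open>\<open>choose_two\<close> subtracts in the naturals; splitting on
      \<open>n\<close> reconciles this with \<open>real n - 1\<close>.\<close>
    by (cases n) (simp_all add: choose_two real_of_nat_div algebra_simps)
  show ?thesis
  proof (intro conjI impI ballI)
    show "1 \<le> k" "k \<le> n - 1" by (fact k1, fact kn)
    show "Digraph_Component.connected (with_proj G) \<longleftrightarrow>
      (\<Sum>i = 1..n. \<Sum>j = 1..k. x i j) = n * (n - 1)" by (fact conn)
    show "real (card (components G)) = (\<Sum>d = 0..n - 1. real (card (S d)) / (real d + 1))"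
      by (fact components)
    show "real (card (components G)) = (\<Sum>d = 1..n - 1. real (card (S d)) / (real d + 1))"
      if "\<forall>u\<in>pverts G. degree G u \<noteq> 0" by (rule components'[OF that])
  next
    assume con: "Digraph_Component.connected (with_proj G)"
    show "radius G = Max {j \<in> {1..k}. \<forall>i\<in>{1..n}. x i j \<noteq> 0}"
      using radius_eq_Max[OF ne radius_pos[OF con]] ball_v[of "\<lambda>u. card (dist_nbhd G _ u) \<noteq> 0"]
      by (simp only: xv k)
    show "graph_center G = with_proj G \<restriction> {v i | i. i \<in> {1..n} \<and> x i (radius G) \<noteq> 0 \<and>
        (\<forall>j\<in>{1..k}. j > radius G \<longrightarrow> x i j = 0)}"
      unfolding xv graph_center_eq k
      by (subst image_v[of "\<lambda>u. card (dist_nbhd G (radius G) u) \<noteq> 0 \<and>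
        (\<forall>j\<in>{1..diameter G}. radius G < j \<longrightarrow> card (dist_nbhd G j u) = 0)"]) (rule refl)
    show "closeness G (v i) = (real n - 1) / (\<Sum>j = 1..k. real j * real (x i j))"
      if "i \<in> {1..n}" for i
      using closeness_eq[OF v_in[OF that]] by (simp only: xv n k)
    show "average_distance G v =
        1 / (real n * (real n - 1)) * (\<Sum>i = 1..n. \<Sum>j = 1..k. real j * real (x i j))"
      unfolding sum_dist unfolding n by (rule average_distance_eq[OF indexing])
    show "1 / (real n * (real n - 1)) * (\<Sum>i = 1..n. \<Sum>j = 1..k. real j * real (x i j)) =
        1 / (real n * (real n - 1)) * (\<Sum>j = 1..k. \<Sum>i = 1..n. real j * real (x i j))"
      by (subst sum.swap) (rule refl)
    show "periphery G = with_proj G \<restriction> {v i | i. i \<in> {1..n} \<and> x i k \<noteq> 0}"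
      unfolding xv periphery_eq k
      by (subst image_v[of "\<lambda>u. card (dist_nbhd G (diameter G) u) \<noteq> 0"]) (rule refl)
    show "degree_sequence G = map (\<lambda>i. x i 1) [1..<n + 1]"
      using degree_sequence_eq[OF indexing] k1 by (simp only: xv n k)
    show "degree G (v i) = x i 1" for i
      by (simp only: degree_eq_card_dist_nbhd xv)
    show "real (card (uedges G)) = 1 / 2 * (\<Sum>i = 1..n. real (x i 1))"
      by (rule card_uedges[OF con])
    show "density G = (1 / 2 * (\<Sum>i = 1..n. real (x i 1))) / real (n choose 2)"
      by (simp only: density_def card_uedges[OF con] n)
    then show "density G = 2 * (1 / 2 * (\<Sum>i = 1..n. real (x i 1))) / (real n * (real n - 1))"
      by (simp add: choose)
    show "(\<Sum>i = 1..n. int (x i j)) =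
        2 * (int (card (uedges (graph_power G j))) - int (card (uedges (graph_power G (j - 1)))))"
      if "j \<in> {1..k}" for j
    proof -
      obtain j' where j: "j = Suc j'" using \<open>j \<in> {1..k}\<close> by (cases j) auto
      \<comment> \<open>Column \<open>j\<close> is the difference of two consecutive partial sums of
        columns. It is stated additively to avoid truncated subtraction; for \<open>j = 1\<close>
        the earlier partial sum is empty.\<close>
      have "(\<Sum>i = 1..n. x i j) + 2 * card (uedges (graph_power G (j - 1))) =
          2 * card (uedges (graph_power G j))"
        unfolding edges[OF con, symmetric] by (simp add: j)
      then have "int (\<Sum>i = 1..n. x i j) + 2 * int (card (uedges (graph_power G (j - 1)))) =
          2 * int (card (uedges (graph_power G j)))"
        by (metis of_nat_add of_nat_mult of_nat_numeral)
      then show ?thesis by simp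
    qed
    show "(\<Sum>j = 1..s. \<Sum>i = 1..n. x i j) = 2 * card (uedges (graph_power G s))" for s
      by (rule edges[OF con])
  qed
qed

end
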